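(* Let $b\in\mathbb{C}$ be non-zero and let $\mathbb{K}$ be the $\mathbb{C}$-algebra of hybrid numbers with basis $\{1,g,\mu,\nu\}$. Define linear maps $\Delta:\mathbb{K}\to\mathbb{K}\otimes\mathbb{K}$, $\varepsilon:\mathbb{K}\to\mathbb{C}$ by $$\Delta(1)=\tfrac12\, 1\otimes 1-\tfrac12\,\mu\otimes\mu-\tfrac i2\,\nu\otimes\mu-\tfrac i2\,\mu\otimes\nu+\tfrac12\,\nu\otimes\nu,$$ $$\Delta(g)=-\tfrac12\,\mu\otimes 1-\tfrac i2\,\nu\otimes 1+b\,g\otimes g+b\,\mu\otimes g+ib\,\nu\otimes g-\tfrac12\,1\otimes\mu+b\,g\otimes\mu+b\,\mu\otimes\mu+ib\,\nu\otimes\mu-\tfrac i2\,1\otimes\nu+ib\,g\otimes\nu+ib\,\mu\otimes\nu-b\,\nu\otimes\nu,$$ $$\Delta(\mu)=\tfrac1{2b}\,\mu\otimes\mu,$$ $$\Delta(\nu)=-\tfrac i2\,\mu\otimes 1+\tfrac12\,\nu\otimes 1-\tfrac i2\,1\otimes\mu+\tfrac i{2b}\,\mu\otimes\mu+\tfrac12\,1\otimes\nu,$$ $$\varepsilon(1)=2,\quad \varepsilon(g)=\tfrac1b,\quad \varepsilon(\mu)=2b,\quad \varepsilon(\nu)=2ib.$$ Then, with this coalgebra structure, $\mathbb{K}$ is a weak Hopf algebra with antipode $S:\mathbb{K}\to\mathbb{K}$ the linear map given by $$S(1)=1,\qquad S(g)=\left(-1+\tfrac1{2b^2}\right)\mu-i\nu,$$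 $$S(\mu)=2b^2 g+2b^2\mu+2ib^2\nu,$$ $$S(\nu)=2ib^2 g-(i-2ib^2)\mu+(1-2b^2)\nu.$$
   Context: All vector spaces, linear maps and tensor products are over $\mathbb{C}$; $i$ is the imaginary unit. Hybrid numbers: $\mathbb{K}$ is the 4-dimensional associative unital $\mathbb{C}$-algebra with basis $1,g,\mu,\nu$ (unit $1$) and multiplication $g^2=-1$, $\mu^2=0$, $\nu^2=1$, $g\mu=1-\nu$, $\mu g=1+\nu$, $g\nu=\mu+g$, $\nu g=-\mu-g$, $\mu\nu=-\mu$, $\nu\mu=\mu$. Sweedler notation $\Delta(h)=h_{(1)}\otimes h_{(2)}$ (summation omitted), $\Delta^2=(\Delta\otimes \mathrm{id})\Delta=(\mathrm{id}\otimes\Delta)\Delta$. A weak Hopf algebra with antipode $S$ is a sextuple $(H,m,1,\Delta,\varepsilon,S)$ such that $(H,m,1)$ is an algebra, $(H,\Delta,\varepsilon)$ is a coalgebra, $S:H\to H$ is linear, and (1) $\Delta(kh)=\Delta(k)\Delta(h)$ for all $h,k\in H$; (2) $\varepsilon(kh_{(1)})\varepsilon(h_{(2)}g)=\varepsilon(khg)=\varepsilon(kh_{(2)})\varepsilon(h_{(1)}g)$ for all $h,k,g\in H$; (3) $(1\otimes\Delta(1))(\Delta(1)\otimes 1)=\Delta^2(1)=(\Delta(1)\otimes 1)(1\otimes\Delta(1))$; (4) $h_{(1)}S(h_{(2)})=\varepsilon_t(h)$, $S(h_{(1)})h_{(2)}=\varepsilon_s(h)$, $S(h_{(1)})h_{(2)}S(h_{(3)})=S(h)$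 for all $h\in H$, where $\varepsilon_t(h)=\varepsilon(1_{(1)}h)1_{(2)}$ and $\varepsilon_s(h)=\varepsilon(h1_{(2)})1_{(1)}$. *)

theory Defs
  imports Complex_Main "HOL-Library.Poly_Mapping"
begin

section \<open>Complex vector spaces and algebras\<close>

class scaleC =
  fixes scaleC :: "complex \<Rightarrow> 'a \<Rightarrow> 'a"  (infixr \<open>*\<^sub>C\<close> 75)

class complex_vector = scaleC + ab_group_add +
  assumes scaleC_add_right: "a *\<^sub>C (x + y) = a *\<^sub>C x + a *\<^sub>C y"
    and scaleC_add_left: "(a + b) *\<^sub>C x = a *\<^sub>C x + b *\<^sub>C x"
    and scaleC_scaleC: "a *\<^sub>C (b *\<^sub>C x) = (a * b) *\<^sub>C x"
    and scaleC_one: "1 *\<^sub>C x = x"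

global_interpretation complex_vector: vector_space "scaleC :: complex \<Rightarrow> 'a \<Rightarrow> 'a::complex_vector"
  by unfold_locales (simp_all add: scaleC_add_right scaleC_add_left scaleC_scaleC scaleC_one)

abbreviation clinear :: "('a::complex_vector \<Rightarrow> 'b::complex_vector) \<Rightarrow> bool"
  where "clinear \<equiv> Vector_Spaces.linear scaleC scaleC"

definition cbilinear :: "('a::complex_vector \<Rightarrow> 'b::complex_vector \<Rightarrow> 'c::complex_vector) \<Rightarrow> bool"
  where "cbilinear f \<longleftrightarrow> (\<forall>a. clinear (f a)) \<and> (\<forall>b. clinear (\<lambda>a. f a b))"

text \<open>Built on \<^class>\<open>monoid_mult\<close> rather than \<^class>\<open>ring_1\<close>, so that the zero algebra is allowed.\<close>

class complex_unital_algebra = complex_vector + ring + monoid_mult +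
  assumes mult_scaleC_left [simp]: "(a *\<^sub>C x) * y = a *\<^sub>C (x * y)"
    and mult_scaleC_right [simp]: "x * (a *\<^sub>C y) = a *\<^sub>C (x * y)"

instantiation complex :: complex_unital_algebra
begin
definition scaleC_complex :: "complex \<Rightarrow> complex \<Rightarrow> complex"
  where scaleC_complex_eq [simp]: "scaleC_complex a x = a * x"
instance by standard (simp_all add: algebra_simps)
end

lemma clinearI:
  assumes "\<And>x y. f (x + y) = f x + f y" "\<And>c x. f (c *\<^sub>C x) = c *\<^sub>C f x"
  shows "clinear f"
  by unfold_locales (simp_all add: assms)

lemma clinear_add: "clinear f \<Longrightarrow> f (x + y) = f x + f y"
  by (simp add: Vector_Spaces.linear_iff)

lemma clinear_scale: "clinear f \<Longrightarrow> f (c *\<^sub>C x) = c *\<^sub>C f x"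
  by (simp add: Vector_Spaces.linear_iff)

lemma clinear_zero: "clinear f \<Longrightarrow> f 0 = 0"
  using clinear_scale[of f 0 0] by simp

lemma clinear_uminus: "clinear f \<Longrightarrow> f (- x) = - f x"
  using clinear_scale[of f "-1" x] by simp

lemma clinear_diff: "clinear f \<Longrightarrow> f (x - y) = f x - f y"
  using clinear_add[of f x "- y"] by (simp add: clinear_uminus)

lemma clinear_compose: "clinear f \<Longrightarrow> clinear g \<Longrightarrow> clinear (\<lambda>x. g (f x))"
  by (rule clinearI) (simp_all add: clinear_add clinear_scale)

lemma clinear_id: "clinear (\<lambda>x. x)" "clinear id"
  by (rule clinearI; simp)+

lemma cbilinearI:
  assumes "\<And>a x y. f a (x + y) = f a x + f a y" "\<And>c a x. f a (c *\<^sub>C x) = c *\<^sub>C f a x"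
    and "\<And>a x y. f (x + y) a = f x a + f y a" "\<And>c a x. f (c *\<^sub>C x) a = c *\<^sub>C f x a"
  shows "cbilinear f"
  unfolding cbilinear_def by (auto intro!: clinearI simp: assms)

lemma cbilinearD:
  assumes "cbilinear f"
  shows "f a (x + y) = f a x + f a y" "f a (c *\<^sub>C x) = c *\<^sub>C f a x"
    and "f (u + v) b = f u b + f v b" "f (c *\<^sub>C u) b = c *\<^sub>C f u b"
  using assms clinear_add[of "\<lambda>x. f x b"] clinear_scale[of "\<lambda>x. f x b"]
  by (auto simp: cbilinear_def clinear_add clinear_scale)

section \<open>The tensor product of two complex vector spaces\<close>

instantiation poly_mapping :: (type, complex_vector) complex_vector
begin
definition scaleC_poly_mapping :: "complex \<Rightarrow> ('a \<Rightarrow>\<^sub>0 'b) \<Rightarrow> ('a \<Rightarrow>\<^sub>0 'b)"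
  where "scaleC_poly_mapping c p = Poly_Mapping.map (scaleC c) p"
lemma lookup_scaleC [simp]:
  "Poly_Mapping.lookup (c *\<^sub>C (p :: 'a \<Rightarrow>\<^sub>0 'b)) x = c *\<^sub>C Poly_Mapping.lookup p x"
  by (simp add: scaleC_poly_mapping_def Poly_Mapping.map.rep_eq when_def)
instance
  by standard (rule poly_mapping_eqI;
    simp add: lookup_add scaleC_add_right scaleC_add_left scaleC_scaleC scaleC_one)+
end

text \<open>
  The type \<open>('a \<times> 'b) \<Rightarrow>\<^sub>0 complex\<close> of finitely supported functions is the vector space with basis
  \<open>'a \<times> 'b\<close>; the tensor product is its quotient by the subspace spanned by the bilinearity relations.
\<close>

definition tensor_relations :: "(('a::complex_vector \<times> 'b::complex_vector) \<Rightarrow>\<^sub>0 complex) set"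
  where "tensor_relations =
     {Poly_Mapping.single (a + a', b) 1 - Poly_Mapping.single (a, b) 1
        - Poly_Mapping.single (a', b) 1 | a a' b. True}
   \<union> {Poly_Mapping.single (a, b + b') 1 - Poly_Mapping.single (a, b) 1
        - Poly_Mapping.single (a, b') 1 | a b b'. True}
   \<union> {Poly_Mapping.single (c *\<^sub>C a, b) 1 - c *\<^sub>C Poly_Mapping.single (a, b) 1 | c a b. True}
   \<union> {Poly_Mapping.single (a, c *\<^sub>C b) 1 - c *\<^sub>C Poly_Mapping.single (a, b) 1 | c a b. True}"

definition tensor_eq ::
  "(('a::complex_vector \<times> 'b::complex_vector) \<Rightarrow>\<^sub>0 complex) \<Rightarrow> (('a \<times> 'b) \<Rightarrow>\<^sub>0 complex) \<Rightarrow> bool"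
  where "tensor_eq p q \<longleftrightarrow> p - q \<in> complex_vector.span tensor_relations"

lemma equivp_tensor_eq: "equivp tensor_eq"
proof (rule equivpI)
  show "reflp tensor_eq"
    by (simp add: reflp_def tensor_eq_def complex_vector.span_zero)
  show "symp tensor_eq"
    unfolding symp_def tensor_eq_def
    by (metis complex_vector.span_neg minus_diff_eq)
  show "transp tensor_eq"
    unfolding transp_def tensor_eq_def
    using complex_vector.span_add by fastforce
qed

quotient_type (overloaded) ('a, 'b) tensor (infixr \<open>\<otimes>\<close> 22) =
  "(('a::complex_vector \<times> 'b::complex_vector) \<Rightarrow>\<^sub>0 complex)" / tensor_eq
  by (rule equivp_tensor_eq)

instantiation tensor :: (complex_vector, complex_vector) complex_vector
begin
lift_definition zero_tensor :: "'a \<otimes> 'b" is 0 .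
lift_definition plus_tensor :: "('a \<otimes> 'b) \<Rightarrow> ('a \<otimes> 'b) \<Rightarrow> ('a \<otimes> 'b)" is "(+)"
  unfolding tensor_eq_def add_diff_add
  by (rule complex_vector.span_add)
lift_definition uminus_tensor :: "('a \<otimes> 'b) \<Rightarrow> ('a \<otimes> 'b)" is uminus
  unfolding tensor_eq_def minus_diff_minus
  by (rule complex_vector.span_neg)
lift_definition minus_tensor :: "('a \<otimes> 'b) \<Rightarrow> ('a \<otimes> 'b) \<Rightarrow> ('a \<otimes> 'b)" is "(-)"
proof -
  fix p p' q q' :: "('a \<times> 'b) \<Rightarrow>\<^sub>0 complex"
  assume "tensor_eq p p'" "tensor_eq q q'"
  then have "(p - p') - (q - q') \<in> complex_vector.span tensor_relations"
    unfolding tensor_eq_def by (rule complex_vector.span_diff)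
  also have "(p - p') - (q - q') = (p - q) - (p' - q')"
    by (simp add: algebra_simps)
  finally show "tensor_eq (p - q) (p' - q')"
    by (simp add: tensor_eq_def)
qed
lift_definition scaleC_tensor :: "complex \<Rightarrow> ('a \<otimes> 'b) \<Rightarrow> ('a \<otimes> 'b)" is scaleC
  unfolding tensor_eq_def complex_vector.scale_right_diff_distrib[symmetric]
  by (rule complex_vector.span_scale)
instance
  by standard (transfer; simp add: tensor_eq_def complex_vector.span_zero algebra_simps
      scaleC_add_right scaleC_add_left scaleC_scaleC scaleC_one)+
end

lift_definition tensor_prod :: "'a::complex_vector \<Rightarrow> 'b::complex_vector \<Rightarrow> 'a \<otimes> 'b"  (infixr \<open>\<otimes>\<close> 76)
  is "\<lambda>a b. Poly_Mapping.single (a, b) 1" .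

definition free_extend :: "('x \<Rightarrow> 'c::complex_vector) \<Rightarrow> ('x \<Rightarrow>\<^sub>0 complex) \<Rightarrow> 'c"
  where "free_extend f p = (\<Sum>x\<in>Poly_Mapping.keys p. Poly_Mapping.lookup p x *\<^sub>C f x)"

text \<open>
  For bilinear \<open>f\<close> this is the linear map on the tensor product with \<open>a \<otimes> b \<mapsto> f a b\<close>; see
  \<open>tensor_lift_tensor_prod\<close>, \<open>clinear_tensor_lift\<close> and \<open>tensor_lift_unique\<close> below. It is not meaningful
  for other \<open>f\<close>. In Sweedler notation, \<open>tensor_lift f (\<Delta> h)\<close> is \<open>f h\<^sub>(\<^sub>1\<^sub>) h\<^sub>(\<^sub>2\<^sub>)\<close>.
\<close>

definition tensor_lift ::
  "('a::complex_vector \<Rightarrow> 'b::complex_vector \<Rightarrow> 'c::complex_vector) \<Rightarrow> 'a \<otimes> 'b \<Rightarrow> 'c"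
  where "tensor_lift f t = free_extend (\<lambda>(a, b). f a b) (rep_tensor t)"

lemma free_extend_superset:
  assumes "finite K" "Poly_Mapping.keys p \<subseteq> K"
  shows "free_extend f p = (\<Sum>x\<in>K. Poly_Mapping.lookup p x *\<^sub>C f x)"
  unfolding free_extend_def
  by (rule sum.mono_neutral_left) (use assms in \<open>auto simp: in_keys_iff\<close>)

lemma clinear_free_extend: "clinear (free_extend f)"
proof (rule clinearI)
  fix p q :: "'a \<Rightarrow>\<^sub>0 complex"
  let ?K = "Poly_Mapping.keys p \<union> Poly_Mapping.keys q"
  have "free_extend f (p + q) = (\<Sum>x\<in>?K. Poly_Mapping.lookup (p + q) x *\<^sub>C f x)"
    by (rule free_extend_superset) (use Poly_Mapping.keys_add[of p q] in auto)
  then show "free_extend f (p + q) = free_extend f p + free_extend f q"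
    by (simp add: free_extend_superset[of ?K p] free_extend_superset[of ?K q]
        lookup_add scaleC_add_left sum.distrib)
next
  fix c and p :: "'a \<Rightarrow>\<^sub>0 complex"
  have "free_extend f (c *\<^sub>C p)
      = (\<Sum>x\<in>Poly_Mapping.keys p. Poly_Mapping.lookup (c *\<^sub>C p) x *\<^sub>C f x)"
    by (rule free_extend_superset) (auto simp: in_keys_iff)
  then show "free_extend f (c *\<^sub>C p) = c *\<^sub>C free_extend f p"
    by (simp add: free_extend_def complex_vector.scale_sum_right)
qed

lemma free_extend_single [simp]: "free_extend f (Poly_Mapping.single x c) = c *\<^sub>C f x"
  by (simp add: free_extend_superset[of "{x}"])

lemma tensor_lift_abs:
  assumes f: "cbilinear f"
  shows "tensor_lift f (abs_tensor p) = free_extend (\<lambda>(a, b). f a b) p"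
proof -
  let ?F = "free_extend (\<lambda>(a, b). f a b)"
  have sub: "complex_vector.subspace {p. ?F p = 0}"
    by (rule complex_vector.subspaceI)
      (simp_all add: clinear_zero clinear_add clinear_scale clinear_free_extend)
  have "tensor_relations \<subseteq> {p. ?F p = 0}"
    by (auto simp: tensor_relations_def clinear_diff[OF clinear_free_extend]
        clinear_scale[OF clinear_free_extend] cbilinearD[OF f] scaleC_one)
  then have span: "complex_vector.span tensor_relations \<subseteq> {p. ?F p = 0}"
    by (rule complex_vector.span_minimal[OF _ sub])
  have "tensor_eq (rep_tensor (abs_tensor p)) p"
    by (metis Quotient3_tensor rep_abs_rsp_left Quotient3_rep_abs Quotient3_rep_reflp
        equivp_tensor_eq equivp_reflp)
  then have "?F (rep_tensor (abs_tensor p) - p) = 0"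
    using span by (auto simp: tensor_eq_def)
  then show ?thesis
    by (simp add: tensor_lift_def clinear_diff[OF clinear_free_extend])
qed

lemma tensor_lift_tensor_prod:
  "cbilinear f \<Longrightarrow> tensor_lift f (a \<otimes> b) = f a b"
  by (simp add: tensor_prod.abs_eq tensor_lift_abs scaleC_one)

lemma clinear_tensor_lift:
  assumes f: "cbilinear f"
  shows "clinear (tensor_lift f)"
proof (rule clinearI)
  fix s t :: "'a \<otimes> 'b"
  show "tensor_lift f (s + t) = tensor_lift f s + tensor_lift f t"
    by (induct s; induct t)
      (simp add: plus_tensor.abs_eq tensor_lift_abs[OF f] clinear_add[OF clinear_free_extend])
next
  fix c and t :: "'a \<otimes> 'b"
  show "tensor_lift f (c *\<^sub>C t) = c *\<^sub>C tensor_lift f t"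
    by (induct t)
      (simp add: scaleC_tensor.abs_eq tensor_lift_abs[OF f] clinear_scale[OF clinear_free_extend])
qed

lemma tensor_prod_simps:
  "(a + a') \<otimes> b = a \<otimes> b + a' \<otimes> b"
  "a \<otimes> (b + b') = a \<otimes> b + a \<otimes> b'"
  "(c *\<^sub>C a) \<otimes> b = c *\<^sub>C (a \<otimes> b)"
  "a \<otimes> (c *\<^sub>C b) = c *\<^sub>C (a \<otimes> b)"
  by (transfer, unfold tensor_eq_def tensor_relations_def diff_diff_eq[symmetric],
    rule complex_vector.span_base, blast)+

lemma cbilinear_tensor_prod: "cbilinear tensor_prod"
  by (rule cbilinearI) (simp_all add: tensor_prod_simps)

lemma tensor_induct [case_names prod add]:
  assumes prod: "\<And>a b. P (a \<otimes> b)" and add: "\<And>s t. P s \<Longrightarrow> P t \<Longrightarrow> P (s + t)"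
  shows "P t"
proof (induct t)
  fix p :: "('a \<times> 'b) \<Rightarrow>\<^sub>0 complex"
  have single: "P (abs_tensor (Poly_Mapping.single k v))" for k v
  proof (cases k)
    case (Pair a b)
    have "Poly_Mapping.single (a, b) v = v *\<^sub>C Poly_Mapping.single (a, b) 1"
      by (rule poly_mapping_eqI) (simp add: lookup_single when_def)
    then have "abs_tensor (Poly_Mapping.single k v) = (v *\<^sub>C a) \<otimes> b"
      by (simp add: Pair tensor_prod_simps(3) scaleC_tensor.abs_eq[symmetric]
          tensor_prod.abs_eq[symmetric])
    then show ?thesis by (simp add: prod)
  qed
  show "P (abs_tensor p)"
  proof (induct p rule: Poly_Mapping.update_induct)
    case const
    then show ?case using single[of undefined 0] by simp
  next
    case (update p k v)
    then have "Poly_Mapping.update k v p = p + Poly_Mapping.single k v"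
      by (intro poly_mapping_eqI)
        (auto simp: lookup_add lookup_single lookup_update when_def in_keys_iff)
    then show ?case
      using add[OF update(3) single[of k v]] by (simp add: plus_tensor.abs_eq)
  qed
qed

lemma tensor_lift_unique:
  assumes f: "clinear f" and g: "clinear g" and eq: "\<And>a b. f (a \<otimes> b) = g (a \<otimes> b)"
  shows "f = g"
proof
  fix t show "f t = g t"
    by (induct t rule: tensor_induct) (simp_all add: eq clinear_add[OF f] clinear_add[OF g])
qed

lemma tensor_lift_fun_add:
  "tensor_lift (\<lambda>a b. f a b + g a b) t = tensor_lift f t + tensor_lift g t"
  by (simp add: tensor_lift_def free_extend_def case_prod_unfold scaleC_add_right sum.distrib)

lemma tensor_lift_fun_scale:
  "tensor_lift (\<lambda>a b. c *\<^sub>C f a b) t = c *\<^sub>C tensor_lift f t"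
  by (simp add: tensor_lift_def free_extend_def case_prod_unfold complex_vector.scale_sum_right
      mult.commute)

definition tensor_map ::
  "('a::complex_vector \<Rightarrow> 'c::complex_vector) \<Rightarrow> ('b::complex_vector \<Rightarrow> 'd::complex_vector) \<Rightarrow>
    'a \<otimes> 'b \<Rightarrow> 'c \<otimes> 'd"
  where "tensor_map f g = tensor_lift (\<lambda>a b. f a \<otimes> g b)"

definition tensor_assoc ::
  "('a::complex_vector \<otimes> 'b::complex_vector) \<otimes> 'c::complex_vector \<Rightarrow> 'a \<otimes> ('b \<otimes> 'c)"
  where "tensor_assoc = tensor_lift (\<lambda>t c. tensor_lift (\<lambda>a b. a \<otimes> (b \<otimes> c)) t)"

lemma cbilinear_tensor_map:
  "clinear f \<Longrightarrow> clinear g \<Longrightarrow> cbilinear (\<lambda>a b. f a \<otimes> g b)"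
  by (rule cbilinearI) (simp_all add: clinear_add clinear_scale tensor_prod_simps)

lemma tensor_map_tensor_prod:
  "clinear f \<Longrightarrow> clinear g \<Longrightarrow> tensor_map f g (a \<otimes> b) = f a \<otimes> g b"
  by (simp add: tensor_map_def tensor_lift_tensor_prod cbilinear_tensor_map)

lemma clinear_tensor_map:
  "clinear f \<Longrightarrow> clinear g \<Longrightarrow> clinear (tensor_map f g)"
  by (simp add: tensor_map_def clinear_tensor_lift cbilinear_tensor_map)

lemma cbilinear_assoc_inner: "cbilinear (\<lambda>a b. a \<otimes> (b \<otimes> c))"
  by (rule cbilinearI) (simp_all add: tensor_prod_simps)

lemma cbilinear_assoc_outer: "cbilinear (\<lambda>t c. tensor_lift (\<lambda>a b. a \<otimes> (b \<otimes> c)) t)"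
  by (rule cbilinearI)
    (simp_all add: tensor_prod_simps tensor_lift_fun_add tensor_lift_fun_scale
      clinear_add[OF clinear_tensor_lift[OF cbilinear_assoc_inner]]
      clinear_scale[OF clinear_tensor_lift[OF cbilinear_assoc_inner]])

lemma tensor_assoc_tensor_prod: "tensor_assoc ((a \<otimes> b) \<otimes> c) = a \<otimes> (b \<otimes> c)"
  by (simp add: tensor_assoc_def tensor_lift_tensor_prod cbilinear_assoc_inner cbilinear_assoc_outer)

lemma clinear_tensor_assoc: "clinear tensor_assoc"
  by (simp add: tensor_assoc_def clinear_tensor_lift cbilinear_assoc_outer)

definition tensor_mult ::
  "'a::complex_unital_algebra \<otimes> 'b::complex_unital_algebra \<Rightarrow> 'a \<otimes> 'b \<Rightarrow> 'a \<otimes> 'b"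
  where "tensor_mult s t =
    tensor_lift (\<lambda>a b. tensor_lift (\<lambda>c d. (a * c) \<otimes> (b * d)) t) s"

lemma cbilinear_tensor_mult_inner:
  fixes a :: "'a::complex_unital_algebra" and b :: "'b::complex_unital_algebra"
  shows "cbilinear (\<lambda>c d. (a * c) \<otimes> (b * d))"
  by (rule cbilinearI) (simp_all add: tensor_prod_simps distrib_left)

lemma cbilinear_tensor_mult_outer:
  fixes t :: "'a::complex_unital_algebra \<otimes> 'b::complex_unital_algebra"
  shows "cbilinear (\<lambda>a b. tensor_lift (\<lambda>c d. (a * c) \<otimes> (b * d)) t)"
  by (rule cbilinearI)
    (simp_all add: tensor_prod_simps distrib_right tensor_lift_fun_add tensor_lift_fun_scale)

lemma cbilinear_tensor_mult:
  "cbilinear (tensor_mult :: 'a::complex_unital_algebra \<otimes> 'b::complex_unital_algebra \<Rightarrow> _)"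
  by (rule cbilinearI)
    (simp_all add: tensor_mult_def tensor_lift_fun_add tensor_lift_fun_scale
      clinear_add[OF clinear_tensor_lift[OF cbilinear_tensor_mult_inner]]
      clinear_scale[OF clinear_tensor_lift[OF cbilinear_tensor_mult_inner]]
      clinear_add[OF clinear_tensor_lift[OF cbilinear_tensor_mult_outer]]
      clinear_scale[OF clinear_tensor_lift[OF cbilinear_tensor_mult_outer]])

lemma tensor_mult_prod: "tensor_mult (a \<otimes> b) (c \<otimes> d) = (a * c) \<otimes> (b * d)"
  unfolding tensor_mult_def tensor_lift_tensor_prod[OF cbilinear_tensor_mult_outer]
  by (rule tensor_lift_tensor_prod[OF cbilinear_tensor_mult_inner])

instantiation tensor :: (complex_unital_algebra, complex_unital_algebra) complex_unital_algebra
begin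

definition one_tensor :: "'a \<otimes> 'b"
  where "1 = (1 :: 'a) \<otimes> (1 :: 'b)"

definition times_tensor :: "'a \<otimes> 'b \<Rightarrow> 'a \<otimes> 'b \<Rightarrow> 'a \<otimes> 'b"
  where "s * t = tensor_mult s t"

instance
proof
  fix r s t :: "'a \<otimes> 'b" and c :: complex
  note bil = cbilinearD[OF cbilinear_tensor_mult]
  show "r * s * t = r * (s * t)"
    unfolding times_tensor_def
  proof (induct r rule: tensor_induct)
    case (prod a b)
    show ?case
    proof (induct s rule: tensor_induct)
      case (prod a' b')
      show ?case
        by (induct t rule: tensor_induct) (simp_all add: bil tensor_mult_prod mult.assoc)
    qed (simp add: bil)
  qed (simp add: bil)
  show "(r + s) * t = r * t + s * t" "r * (s + t) = r * s + r * t"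
    "(c *\<^sub>C s) * t = c *\<^sub>C (s * t)" "s * (c *\<^sub>C t) = c *\<^sub>C (s * t)"
    by (simp_all add: times_tensor_def bil)
  show "1 * t = t" "t * 1 = t"
    unfolding times_tensor_def one_tensor_def
    by (induct t rule: tensor_induct) (simp_all add: bil tensor_mult_prod)
qed

end

lemma mult_tensor_prod:
  fixes a c :: "'a::complex_unital_algebra" and b d :: "'b::complex_unital_algebra"
  shows "(a \<otimes> b) * (c \<otimes> d) = (a * c) \<otimes> (b * d)"
  by (simp add: times_tensor_def tensor_mult_prod)

section \<open>Weak Hopf algebras\<close>

text \<open>The counit laws are read through the identifications of \<open>\<complex> \<otimes> H\<close> and \<open>H \<otimes> \<complex>\<close> with \<open>H\<close>.\<close>

locale coalgebra =
  fixes \<Delta> :: "'a::complex_vector \<Rightarrow> 'a \<otimes> 'a" and \<epsilon> :: "'a \<Rightarrow> complex"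
  assumes clinear_comult: "clinear \<Delta>"
    and clinear_counit: "clinear \<epsilon>"
    and coassoc: "tensor_assoc (tensor_map \<Delta> id (\<Delta> h)) = tensor_map id \<Delta> (\<Delta> h)"
    and counit_left: "tensor_lift (\<lambda>x y. \<epsilon> x *\<^sub>C y) (\<Delta> h) = h"
    and counit_right: "tensor_lift (\<lambda>x y. \<epsilon> y *\<^sub>C x) (\<Delta> h) = h"
begin

definition comult2 :: "'a \<Rightarrow> 'a \<otimes> ('a \<otimes> 'a)"
  where "comult2 h = tensor_map id \<Delta> (\<Delta> h)"

end

text \<open>
  The algebra \<open>(H, m, 1)\<close> is the type \<open>'a\<close>. Products of elements of \<open>H \<otimes> H \<otimes> H\<close> are taken in
  \<open>'a \<otimes> ('a \<otimes> 'a)\<close>.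
\<close>

locale weak_bialgebra = coalgebra \<Delta> \<epsilon>
  for \<Delta> :: "'a::complex_unital_algebra \<Rightarrow> 'a \<otimes> 'a" and \<epsilon> :: "'a \<Rightarrow> complex" +
  assumes comult_mult: "\<Delta> (k * h) = \<Delta> k * \<Delta> h"
    and counit_mult: "tensor_lift (\<lambda>x y. \<epsilon> (k * x) * \<epsilon> (y * g)) (\<Delta> h) = \<epsilon> (k * h * g)"
    and counit_mult_flip: "\<epsilon> (k * h * g) = tensor_lift (\<lambda>x y. \<epsilon> (k * y) * \<epsilon> (x * g)) (\<Delta> h)"
    and comult_one: "(1 \<otimes> \<Delta> 1) * tensor_assoc (\<Delta> 1 \<otimes> 1) = comult2 1"
    and comult_one_flip: "comult2 1 = tensor_assoc (\<Delta> 1 \<otimes> 1) * (1 \<otimes> \<Delta> 1)"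
begin

definition counit_t :: "'a \<Rightarrow> 'a"  (\<open>\<epsilon>\<^sub>t\<close>)
  where "\<epsilon>\<^sub>t h = tensor_lift (\<lambda>x y. \<epsilon> (x * h) *\<^sub>C y) (\<Delta> 1)"

definition counit_s :: "'a \<Rightarrow> 'a"  (\<open>\<epsilon>\<^sub>s\<close>)
  where "\<epsilon>\<^sub>s h = tensor_lift (\<lambda>x y. \<epsilon> (h * y) *\<^sub>C x) (\<Delta> 1)"

end

locale weak_hopf_algebra = weak_bialgebra \<Delta> \<epsilon>
  for \<Delta> :: "'a::complex_unital_algebra \<Rightarrow> 'a \<otimes> 'a" and \<epsilon> :: "'a \<Rightarrow> complex" +
  fixes S :: "'a \<Rightarrow> 'a"
  assumes clinear_antipode: "clinear S"
    and antipode_right: "tensor_lift (\<lambda>x y. x * S y) (\<Delta> h) = \<epsilon>\<^sub>t h"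
    and antipode_left: "tensor_lift (\<lambda>x y. S x * y) (\<Delta> h) = \<epsilon>\<^sub>s h"
    and antipode_both:
      "tensor_lift (\<lambda>x t. tensor_lift (\<lambda>y z. S x * y * S z) t) (comult2 h) = S h"

section \<open>Hybrid numbers\<close>

text \<open>\<open>Hybrid a b c d\<close> stands for \<open>a 1 + b g + c \<mu> + d \<nu>\<close>.\<close>

datatype hybrid = Hybrid (coeff_1: complex) (coeff_g: complex) (coeff_\<mu>: complex) (coeff_\<nu>: complex)

definition hyb_g :: hybrid where "hyb_g = Hybrid 0 1 0 0"
definition hyb_\<mu> :: hybrid where "hyb_\<mu> = Hybrid 0 0 1 0"
definition hyb_\<nu> :: hybrid where "hyb_\<nu> = Hybrid 0 0 0 1"

text \<open>
  The product below is the bilinear extension of the multiplication table, which is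
  recovered in \<open>hybrid_mult_table\<close>.
\<close>

instantiation hybrid :: complex_unital_algebra
begin

definition "0 = Hybrid 0 0 0 0"
definition "1 = Hybrid 1 0 0 0"
definition "x + y = Hybrid (coeff_1 x + coeff_1 y) (coeff_g x + coeff_g y)
  (coeff_\<mu> x + coeff_\<mu> y) (coeff_\<nu> x + coeff_\<nu> y)"
definition "x - y = Hybrid (coeff_1 x - coeff_1 y) (coeff_g x - coeff_g y)
  (coeff_\<mu> x - coeff_\<mu> y) (coeff_\<nu> x - coeff_\<nu> y)"
definition "- x = Hybrid (- coeff_1 x) (- coeff_g x) (- coeff_\<mu> x) (- coeff_\<nu> x)"
definition "c *\<^sub>C x = Hybrid (c * coeff_1 x) (c * coeff_g x) (c * coeff_\<mu> x) (c * coeff_\<nu> x)"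
definition "x * y = Hybrid
  (coeff_1 x * coeff_1 y - coeff_g x * coeff_g y + coeff_g x * coeff_\<mu> y
     + coeff_\<mu> x * coeff_g y + coeff_\<nu> x * coeff_\<nu> y)
  (coeff_1 x * coeff_g y + coeff_g x * coeff_1 y + coeff_g x * coeff_\<nu> y - coeff_\<nu> x * coeff_g y)
  (coeff_1 x * coeff_\<mu> y + coeff_\<mu> x * coeff_1 y + coeff_g x * coeff_\<nu> y - coeff_\<nu> x * coeff_g y
     - coeff_\<mu> x * coeff_\<nu> y + coeff_\<nu> x * coeff_\<mu> y)
  (coeff_1 x * coeff_\<nu> y + coeff_\<nu> x * coeff_1 y - coeff_g x * coeff_\<mu> y + coeff_\<mu> x * coeff_g y)"

lemmas hybrid_defs = zero_hybrid_def one_hybrid_def plus_hybrid_def minus_hybrid_def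
  uminus_hybrid_def scaleC_hybrid_def times_hybrid_def

instance
  by standard (simp_all add: hybrid_defs algebra_simps)

end

instance hybrid :: ring_1
  by standard (simp add: hybrid_defs)

lemma hybrid_mult_table:
  "hyb_g * hyb_g = - 1" "hyb_\<mu> * hyb_\<mu> = 0" "hyb_\<nu> * hyb_\<nu> = 1"
  "hyb_g * hyb_\<mu> = 1 - hyb_\<nu>" "hyb_\<mu> * hyb_g = 1 + hyb_\<nu>"
  "hyb_g * hyb_\<nu> = hyb_\<mu> + hyb_g" "hyb_\<nu> * hyb_g = - hyb_\<mu> - hyb_g"
  "hyb_\<mu> * hyb_\<nu> = - hyb_\<mu>" "hyb_\<nu> * hyb_\<mu> = hyb_\<mu>"
  by (simp_all add: hyb_g_def hyb_\<mu>_def hyb_\<nu>_def hybrid_defs)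

lemma hybrid_decomp:
  "x = coeff_1 x *\<^sub>C 1 + coeff_g x *\<^sub>C hyb_g + coeff_\<mu> x *\<^sub>C hyb_\<mu> + coeff_\<nu> x *\<^sub>C hyb_\<nu>"
  by (simp add: hyb_g_def hyb_\<mu>_def hyb_\<nu>_def hybrid_defs)

lemma hybrid_distinct: "distinct [1, hyb_g, hyb_\<mu>, hyb_\<nu>]"
  by (simp add: hyb_g_def hyb_\<mu>_def hyb_\<nu>_def hybrid_defs)

lemma hybrid_span: "complex_vector.span {1, hyb_g, hyb_\<mu>, hyb_\<nu>} = UNIV"
proof -
  have "x \<in> complex_vector.span {1, hyb_g, hyb_\<mu>, hyb_\<nu>}" for x
    by (subst hybrid_decomp[of x])
      (intro complex_vector.span_add complex_vector.span_scale complex_vector.span_base; simp)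
  then show ?thesis by auto
qed

lemma hybrid_independent: "complex_vector.independent {1, hyb_g, hyb_\<mu>, hyb_\<nu>}"
proof (rule complex_vector.independent_if_scalars_zero)
  fix f and x :: hybrid
  assume "(\<Sum>x\<in>{1, hyb_g, hyb_\<mu>, hyb_\<nu>}. f x *\<^sub>C x) = 0" and "x \<in> {1, hyb_g, hyb_\<mu>, hyb_\<nu>}"
  then show "f x = 0"
    using hybrid_distinct
    by (auto simp: hyb_g_def hyb_\<mu>_def hyb_\<nu>_def hybrid_defs)
qed simp

lemma hybrid_linear_extension:
  fixes u v w z :: "'a::complex_vector"
  shows "\<exists>!f. clinear f \<and> f 1 = u \<and> f hyb_g = v \<and> f hyb_\<mu> = w \<and> f hyb_\<nu> = z"
proof (rule ex1I)
  let ?f = "\<lambda>x. coeff_1 x *\<^sub>C u + coeff_g x *\<^sub>C v + coeff_\<mu> x *\<^sub>C w + coeff_\<nu> x *\<^sub>C z"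
  have "clinear ?f"
    by (rule clinearI)
      (simp_all add: hybrid_defs scaleC_add_left scaleC_add_right scaleC_scaleC algebra_simps)
  then show "clinear ?f \<and> ?f 1 = u \<and> ?f hyb_g = v \<and> ?f hyb_\<mu> = w \<and> ?f hyb_\<nu> = z"
    by (simp add: hyb_g_def hyb_\<mu>_def hyb_\<nu>_def hybrid_defs scaleC_one)
  fix f assume f: "clinear f \<and> f 1 = u \<and> f hyb_g = v \<and> f hyb_\<mu> = w \<and> f hyb_\<nu> = z"
  then have lin: "clinear f" by simp
  show "f = ?f"
  proof
    fix x
    have "f x = f (coeff_1 x *\<^sub>C 1 + coeff_g x *\<^sub>C hyb_g + coeff_\<mu> x *\<^sub>C hyb_\<mu> + coeff_\<nu> x *\<^sub>C hyb_\<nu>)"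
      using hybrid_decomp[of x] by simp
    also have "\<dots> = ?f x"
      using f by (simp only: clinear_add[OF lin] clinear_scale[OF lin])
    finally show "f x = ?f x" .
  qed
qed

end

theory Submission
  imports Defs
begin

text \<open>
  The algebra of hybrid numbers is isomorphic to \<open>M\<^sub>2(\<complex>)\<close>. Matrix units are read off from the two
  group-like elements \<open>e\<^sub>1\<^sub>2 = \<mu> / 2b\<close> and \<open>e\<^sub>2\<^sub>1 = S(e\<^sub>1\<^sub>2) = b (g + \<mu> + \<i>\<nu>)\<close>, whose products are
  \<open>e\<^sub>1\<^sub>1 = (1 + \<nu> - \<i>\<mu>) / 2\<close> and \<open>e\<^sub>2\<^sub>2 = (1 - \<nu> + \<i>\<mu>) / 2\<close>. In this basis the structure maps are
  \<open>\<Delta>(e\<^sub>i\<^sub>j) = e\<^sub>i\<^sub>j \<otimes> e\<^sub>i\<^sub>j\<close>, \<open>\<epsilon>(e\<^sub>i\<^sub>j) = 1\<close> and \<open>S(e\<^sub>i\<^sub>j) = e\<^sub>j\<^sub>i\<close>, that is, those of the pair groupoid on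
  two objects.
\<close>

lemma clinear_sum: "clinear f \<Longrightarrow> f (\<Sum>i\<in>I. g i) = (\<Sum>i\<in>I. f (g i))"
  by (induction I rule: infinite_finite_induct) (simp_all add: clinear_zero clinear_add)

lemma clinear_mult_left: "clinear (\<lambda>x :: 'a::complex_unital_algebra. a * x)"
  by (rule clinearI) (simp_all add: distrib_left)

lemma clinear_mult_right: "clinear (\<lambda>x :: 'a::complex_unital_algebra. x * a)"
  by (rule clinearI) (simp_all add: distrib_right)

text \<open>\<open>tensor_lift\<close> evaluates its function on one fixed representative of
  \<open>t\<close>, so linear dependence on a parameter passes through the finite sum. This serves
  arguments that sit inside the lifted function, such as \<open>h\<close> in
  \<open>\<epsilon>\<^sub>t h\<close>.\<close>

lemma clinear_tensor_lift_param:
  assumes "\<And>x y. clinear (\<lambda>a. f a x y)"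
  shows "clinear (\<lambda>a. tensor_lift (f a) t)"
proof (rule clinearI)
  fix a b and c :: complex
  have "f (a + b) = (\<lambda>x y. f a x y + f b x y)" "f (c *\<^sub>C a) = (\<lambda>x y. c *\<^sub>C f a x y)"
    by (intro ext clinear_add[OF assms] clinear_scale[OF assms])+
  then show "tensor_lift (f (a + b)) t = tensor_lift (f a) t + tensor_lift (f b) t"
    "tensor_lift (f (c *\<^sub>C a)) t = c *\<^sub>C tensor_lift (f a) t"
    by (simp_all add: tensor_lift_fun_add tensor_lift_fun_scale)
qed

lemma clinear_tensor_prod_left: "clinear (\<lambda>x. x \<otimes> y)"
  and clinear_tensor_prod_right: "clinear (\<lambda>y. x \<otimes> y)"
  by (rule clinearI; simp add: tensor_prod_simps)+

lemma tensor_prod_zero: "x \<otimes> 0 = 0" "0 \<otimes> y = 0"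
  by (simp_all add: clinear_zero[OF clinear_tensor_prod_left] clinear_zero[OF clinear_tensor_prod_right])

text \<open>Moves the Kronecker delta coming from \<open>e_mult\<close> out of a tensor product, so
  that double sums collapse to their diagonal.\<close>

lemma if_tensor_prod:
  "x \<otimes> (if P then y else 0) = (if P then x \<otimes> y else 0)"
  "(if P then y else 0) \<otimes> x = (if P then y \<otimes> x else 0)"
  by (simp_all add: tensor_prod_zero)

text \<open>The algebra of the pair groupoid on a finite set: \<open>e i j\<close> is an arrow, the
  product is composition, arrows are group-like and \<open>S\<close> inverts them. An abstract index
  type lets the axioms be checked uniformly instead of in hybrid coordinates.\<close>

locale matrix_unit_coalgebra =
  fixes e :: "'i::finite \<Rightarrow> 'i \<Rightarrow> 'a::complex_unital_algebra"
    and \<Delta> :: "'a \<Rightarrow> 'a \<otimes> 'a" and \<epsilon> :: "'a \<Rightarrow> complex" and S :: "'a \<Rightarrow> 'a"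
  assumes e_span: "complex_vector.span (range (\<lambda>(i, j). e i j)) = UNIV"
    and e_mult: "e i j * e k l = (if j = k then e i l else 0)"
    and e_one: "1 = (\<Sum>i\<in>UNIV. e i i)"
    and clinear_\<Delta>: "clinear \<Delta>" and \<Delta>_e: "\<Delta> (e i j) = e i j \<otimes> e i j"
    and clinear_\<epsilon>: "clinear \<epsilon>" and \<epsilon>_e: "\<epsilon> (e i j) = 1"
    and clinear_S: "clinear S" and S_e: "S (e i j) = e j i"
begin

text \<open>Linear maps are determined on a spanning set. Every axiom below is multilinear and is
  reduced to matrix units by this rule, one argument at a time.\<close>

lemma clinear_eqI:
  assumes "clinear f" "clinear g" "\<And>i j. f (e i j) = g (e i j)"
  shows "f x = g x"
proof (rule vector_space_pair.linear_eq_on[OF _ assms(1,2)])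
  show "x \<in> complex_vector.span (range (\<lambda>(i, j). e i j))"
    by (simp add: e_span)
qed (auto simp: assms(3) vector_space_pair_def complex_vector.vector_space_axioms)

text \<open>This is only the diagonal part of \<open>1 \<otimes> 1\<close>, which is the sum of
  \<open>e i i \<otimes> e j j\<close> over all pairs. With more than one index, \<Delta> is
  therefore not unital.\<close>

lemma \<Delta>_one: "\<Delta> 1 = (\<Sum>i\<in>UNIV. e i i \<otimes> e i i)"
  by (simp add: e_one clinear_sum[OF clinear_\<Delta>] \<Delta>_e)

lemma tensor_lift_\<Delta>_e: "cbilinear f \<Longrightarrow> tensor_lift f (\<Delta> (e i j)) = f (e i j) (e i j)"
  by (simp add: \<Delta>_e tensor_lift_tensor_prod)

lemma tensor_lift_\<Delta>_one: "cbilinear f \<Longrightarrow> tensor_lift f (\<Delta> 1) = (\<Sum>i\<in>UNIV. f (e i i) (e i i))"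
  by (simp add: \<Delta>_one clinear_sum[OF clinear_tensor_lift] tensor_lift_tensor_prod)

lemma clinear_tensor_lift_\<Delta>: "cbilinear f \<Longrightarrow> clinear (\<lambda>h. tensor_lift f (\<Delta> h))"
  by (rule clinear_compose[OF clinear_\<Delta> clinear_tensor_lift])

lemmas \<epsilon>_simps = clinear_add[OF clinear_\<epsilon>] clinear_scale[OF clinear_\<epsilon>] clinear_zero[OF clinear_\<epsilon>]
lemmas S_simps = clinear_add[OF clinear_S] clinear_scale[OF clinear_S]

lemma clinear_\<Delta>_left: "clinear (\<lambda>h. tensor_map \<Delta> id (\<Delta> h))"
  and clinear_\<Delta>_right: "clinear (\<lambda>h. tensor_map id \<Delta> (\<Delta> h))"
  by (intro clinear_compose[OF clinear_\<Delta>] clinear_tensor_map clinear_\<Delta> clinear_id)+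

lemma \<Delta>_right_e: "tensor_map id \<Delta> (\<Delta> (e i j)) = e i j \<otimes> (e i j \<otimes> e i j)"
  by (simp add: \<Delta>_e tensor_map_tensor_prod clinear_\<Delta> clinear_id)

sublocale coalgebra \<Delta> \<epsilon>
proof
  show "tensor_assoc (tensor_map \<Delta> id (\<Delta> h)) = tensor_map id \<Delta> (\<Delta> h)" for h
    by (rule clinear_eqI[OF clinear_compose[OF clinear_\<Delta>_left clinear_tensor_assoc] clinear_\<Delta>_right])
      (simp add: \<Delta>_e tensor_map_tensor_prod clinear_\<Delta> clinear_id tensor_assoc_tensor_prod)
  have l: "cbilinear (\<lambda>x y. \<epsilon> x *\<^sub>C y)" and r: "cbilinear (\<lambda>x y. \<epsilon> y *\<^sub>C x)"
    by (rule cbilinearI;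
        simp add: \<epsilon>_simps scaleC_add_left scaleC_add_right scaleC_scaleC mult.commute)+
  show "tensor_lift (\<lambda>x y. \<epsilon> x *\<^sub>C y) (\<Delta> h) = h" for h
    by (rule clinear_eqI[OF clinear_tensor_lift_\<Delta>[OF l] clinear_id(1)])
      (simp add: tensor_lift_\<Delta>_e[OF l] \<epsilon>_e scaleC_one)
  show "tensor_lift (\<lambda>x y. \<epsilon> y *\<^sub>C x) (\<Delta> h) = h" for h
    by (rule clinear_eqI[OF clinear_tensor_lift_\<Delta>[OF r] clinear_id(1)])
      (simp add: tensor_lift_\<Delta>_e[OF r] \<epsilon>_e scaleC_one)
qed (simp_all add: clinear_add[OF clinear_\<Delta>] clinear_scale[OF clinear_\<Delta>] \<epsilon>_simps)

text \<open>The two legs of \<open>\<Delta> (e i j)\<close> coincide, so this one identity yields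
  both forms of the weak multiplicativity of \<epsilon>. When \<open>k\<close> and \<open>g\<close>
  are units too, both sides are 1 if all three arrows compose and 0 otherwise.\<close>

lemma \<epsilon>_mult_e: "\<epsilon> (k * e i j) * \<epsilon> (e i j * g) = \<epsilon> (k * e i j * g)"
proof (rule clinear_eqI[where f = "\<lambda>k. \<epsilon> (k * e i j) * \<epsilon> (e i j * g)"])
  show "clinear (\<lambda>k. \<epsilon> (k * e i j) * \<epsilon> (e i j * g))" "clinear (\<lambda>k. \<epsilon> (k * e i j * g))"
    by (rule clinearI; simp add: \<epsilon>_simps distrib_right)+
  fix k l
  show "\<epsilon> (e k l * e i j) * \<epsilon> (e i j * g) = \<epsilon> (e k l * e i j * g)"
  proof (rule clinear_eqI[where x = g])
    show "clinear (\<lambda>g. \<epsilon> (e k l * e i j) * \<epsilon> (e i j * g))" "clinear (\<lambda>g. \<epsilon> (e k l * e i j * g))"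
      by (rule clinearI; simp add: \<epsilon>_simps distrib_left)+
  qed (simp add: e_mult \<epsilon>_e \<epsilon>_simps)
qed

lemma comult2_one: "comult2 1 = (\<Sum>i\<in>UNIV. e i i \<otimes> (e i i \<otimes> e i i))"
  by (simp add: comult2_def e_one clinear_sum[OF clinear_\<Delta>_right] \<Delta>_right_e)

lemma one_tensor_\<Delta>_one: "1 \<otimes> \<Delta> 1 = (\<Sum>i\<in>UNIV. 1 \<otimes> (e i i \<otimes> e i i))"
  by (simp add: \<Delta>_one clinear_sum[OF clinear_tensor_prod_right])

lemma \<Delta>_one_tensor_one: "tensor_assoc (\<Delta> 1 \<otimes> 1) = (\<Sum>i\<in>UNIV. e i i \<otimes> (e i i \<otimes> 1))"
  by (simp add: \<Delta>_one clinear_sum[OF clinear_tensor_prod_left] clinear_sum[OF clinear_tensor_assoc]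
      tensor_assoc_tensor_prod)

sublocale weak_bialgebra \<Delta> \<epsilon>
proof
  show "\<Delta> (k * h) = \<Delta> k * \<Delta> h" for k h
  \<comment> \<open>On units both legs are multiplied alike, and mismatched inner indices make both
    sides vanish.\<close>
  proof (rule clinear_eqI[where x = k])
    fix i j
    show "\<Delta> (e i j * h) = \<Delta> (e i j) * \<Delta> h"
      by (rule clinear_eqI[OF clinear_compose[OF clinear_mult_left clinear_\<Delta>]
            clinear_compose[OF clinear_\<Delta> clinear_mult_left]])
        (simp add: e_mult \<Delta>_e mult_tensor_prod clinear_zero[OF clinear_\<Delta>] tensor_prod_zero)
  qed (rule clinear_compose[OF clinear_mult_right clinear_\<Delta>]
      clinear_compose[OF clinear_\<Delta> clinear_mult_right])+
  fix k h g
  have lin: "clinear (\<lambda>h. \<epsilon> (k * h * g))"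
    by (rule clinearI) (simp_all add: \<epsilon>_simps distrib_left distrib_right)
  have l: "cbilinear (\<lambda>x y. \<epsilon> (k * x) * \<epsilon> (y * g))" and r: "cbilinear (\<lambda>x y. \<epsilon> (k * y) * \<epsilon> (x * g))"
    by (rule cbilinearI; simp add: \<epsilon>_simps algebra_simps)+
  show "tensor_lift (\<lambda>x y. \<epsilon> (k * x) * \<epsilon> (y * g)) (\<Delta> h) = \<epsilon> (k * h * g)"
    by (rule clinear_eqI[OF clinear_tensor_lift_\<Delta>[OF l] lin])
      (simp add: tensor_lift_\<Delta>_e[OF l] \<epsilon>_mult_e)
  show "\<epsilon> (k * h * g) = tensor_lift (\<lambda>x y. \<epsilon> (k * y) * \<epsilon> (x * g)) (\<Delta> h)"
    by (rule clinear_eqI[OF lin clinear_tensor_lift_\<Delta>[OF r]])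
      (simp add: tensor_lift_\<Delta>_e[OF r] \<epsilon>_mult_e)
next
  \<comment> \<open>The middle leg of each term is a product of two diagonal units, hence zero
    unless their indices agree.\<close>
  show "(1 \<otimes> \<Delta> 1) * tensor_assoc (\<Delta> 1 \<otimes> 1) = comult2 1"
    by (simp add: one_tensor_\<Delta>_one \<Delta>_one_tensor_one comult2_one sum_product mult_tensor_prod e_mult
        if_tensor_prod)
  show "comult2 1 = tensor_assoc (\<Delta> 1 \<otimes> 1) * (1 \<otimes> \<Delta> 1)"
    by (simp add: one_tensor_\<Delta>_one \<Delta>_one_tensor_one comult2_one sum_product mult_tensor_prod e_mult
        if_tensor_prod)
qed

lemma cbilinear_\<epsilon>\<^sub>t: "cbilinear (\<lambda>x y. \<epsilon> (x * h) *\<^sub>C y)"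
  and cbilinear_\<epsilon>\<^sub>s: "cbilinear (\<lambda>x y. \<epsilon> (h * y) *\<^sub>C x)"
  by (rule cbilinearI; simp add: \<epsilon>_simps distrib_left distrib_right scaleC_add_left
      scaleC_add_right scaleC_scaleC mult.commute)+

lemma clinear_\<epsilon>\<^sub>t: "clinear \<epsilon>\<^sub>t" and clinear_\<epsilon>\<^sub>s: "clinear \<epsilon>\<^sub>s"
  unfolding counit_t_def counit_s_def
  by (intro clinear_tensor_lift_param clinearI;
      simp add: \<epsilon>_simps distrib_left distrib_right scaleC_add_left scaleC_scaleC)+

text \<open>Of the diagonal terms of \<open>\<Delta> 1\<close>, only the identity arrow at the
  matching end of \<open>e i j\<close> has a nonzero product with it: the left end for
  \<open>\<epsilon>\<^sub>t\<close>, the right end for \<open>\<epsilon>\<^sub>s\<close>.\<close>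

lemma \<epsilon>\<^sub>t_e: "\<epsilon>\<^sub>t (e i j) = e i i" and \<epsilon>\<^sub>s_e: "\<epsilon>\<^sub>s (e i j) = e j j"
  by (simp_all add: counit_t_def counit_s_def tensor_lift_\<Delta>_one cbilinear_\<epsilon>\<^sub>t cbilinear_\<epsilon>\<^sub>s e_mult
      if_distrib[of \<epsilon>] if_distrib[of "\<lambda>c. c *\<^sub>C _"] \<epsilon>_e \<epsilon>_simps scaleC_one cong: if_cong)

text \<open>On units the antipode axioms say that \<open>e j i\<close> is the groupoid inverse of
  \<open>e i j\<close>: the two products are \<open>e i i\<close> and \<open>e j j\<close>, and
  \<open>e j i * e i j * e j i = e j i\<close>.\<close>

sublocale weak_hopf_algebra \<Delta> \<epsilon> S
proof
  have l: "cbilinear (\<lambda>x y. S x * y)" and r: "cbilinear (\<lambda>x y. x * S y)"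
    by (rule cbilinearI; simp add: S_simps distrib_left distrib_right)+
  show "tensor_lift (\<lambda>x y. x * S y) (\<Delta> h) = \<epsilon>\<^sub>t h" for h
    by (rule clinear_eqI[OF clinear_tensor_lift_\<Delta>[OF r] clinear_\<epsilon>\<^sub>t])
      (simp add: tensor_lift_\<Delta>_e[OF r] S_e e_mult \<epsilon>\<^sub>t_e)
  show "tensor_lift (\<lambda>x y. S x * y) (\<Delta> h) = \<epsilon>\<^sub>s h" for h
    by (rule clinear_eqI[OF clinear_tensor_lift_\<Delta>[OF l] clinear_\<epsilon>\<^sub>s])
      (simp add: tensor_lift_\<Delta>_e[OF l] S_e e_mult \<epsilon>\<^sub>s_e)
  have inner: "cbilinear (\<lambda>y z. x * y * S z)" for x
    by (rule cbilinearI) (simp_all add: S_simps distrib_left distrib_right)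
  \<comment> \<open>Linearity in \<open>t\<close> comes from \<open>inner\<close>; \<open>x\<close>
    is a parameter of the inner lifted map, hence \<open>clinear_tensor_lift_param\<close>.\<close>
  have outer: "cbilinear (\<lambda>x t. tensor_lift (\<lambda>y z. S x * y * S z) t)"
    unfolding cbilinear_def
    by (auto intro!: clinear_tensor_lift inner clinear_tensor_lift_param clinearI
        simp: S_simps distrib_right)
  show "tensor_lift (\<lambda>x t. tensor_lift (\<lambda>y z. S x * y * S z) t) (comult2 h) = S h" for h
    unfolding comult2_def
    by (rule clinear_eqI[OF clinear_compose[OF clinear_\<Delta>_right clinear_tensor_lift[OF outer]] clinear_S])
      (simp add: \<Delta>_right_e tensor_lift_tensor_prod[OF outer] tensor_lift_tensor_prod[OF inner]
        S_e e_mult)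
qed (simp_all add: S_simps)

end

text \<open>The indices 1 and 2 are encoded as \<open>True\<close> and \<open>False\<close>.\<close>

definition hyb_unit :: "complex \<Rightarrow> bool \<Rightarrow> bool \<Rightarrow> hybrid" where
  "hyb_unit b i j =
    (if i then if j then (1/2) *\<^sub>C 1 - (\<i>/2) *\<^sub>C hyb_\<mu> + (1/2) *\<^sub>C hyb_\<nu> else (1 / (2 * b)) *\<^sub>C hyb_\<mu>
     else if j then b *\<^sub>C hyb_g + b *\<^sub>C hyb_\<mu> + (\<i> * b) *\<^sub>C hyb_\<nu>
     else (1/2) *\<^sub>C 1 + (\<i>/2) *\<^sub>C hyb_\<mu> - (1/2) *\<^sub>C hyb_\<nu>)"

text \<open>Sixteen products in coordinates. The factors \<open>b\<close> and
  \<open>1 / (2 * b)\<close> of the two off-diagonal units cancel because \<open>b\<close> is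
  nonzero.\<close>

lemma hyb_unit_mult:
  assumes "b \<noteq> 0"
  shows "hyb_unit b i j * hyb_unit b k l = (if j = k then hyb_unit b i l else 0)"
  using assms
  by (cases i; cases j; cases k; cases l)
    (simp_all add: hyb_unit_def hyb_g_def hyb_\<mu>_def hyb_\<nu>_def hybrid_defs mult_ac)

lemma hyb_unit_one: "(\<Sum>i\<in>UNIV. hyb_unit b i i) = 1"
  by (simp add: UNIV_bool hyb_unit_def hyb_g_def hyb_\<mu>_def hyb_\<nu>_def hybrid_defs)

lemma hyb_unit_span:
  assumes "b \<noteq> 0"
  shows "complex_vector.span (range (\<lambda>(i, j). hyb_unit b i j)) = UNIV" (is "?V = _")
proof -
  have unit: "c *\<^sub>C hyb_unit b i j \<in> ?V" for c i j
    by (intro complex_vector.span_scale complex_vector.span_base) auto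
  have "x \<in> ?V" for x
  proof -
    \<comment> \<open>The coefficients solve a triangular system: \<open>hyb_g\<close> occurs only
      in the unit \<open>False True\<close>; with that term removed, \<open>1\<close> and
      \<open>hyb_\<nu>\<close> fix the diagonal coefficients, and \<open>hyb_\<mu>\<close> fixes the
      remaining one.\<close>
    have "x = (coeff_1 x + coeff_\<nu> x - \<i> * coeff_g x) *\<^sub>C hyb_unit b True True
      + (2 * b * (coeff_\<mu> x - coeff_g x + \<i> * (coeff_\<nu> x - \<i> * coeff_g x))) *\<^sub>C hyb_unit b True False
      + (coeff_g x / b) *\<^sub>C hyb_unit b False True
      + (coeff_1 x - coeff_\<nu> x + \<i> * coeff_g x) *\<^sub>C hyb_unit b False False"
      using assms
      by (cases x) (simp add: hyb_unit_def hyb_g_def hyb_\<mu>_def hyb_\<nu>_def hybrid_defs field_simps)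
    also have "\<dots> \<in> ?V"
      by (intro complex_vector.span_add unit)
    finally show ?thesis .
  qed
  then show ?thesis by auto
qed

theorem theorem3p4:
  fixes b :: complex
    and \<Delta> :: "hybrid \<Rightarrow> hybrid \<otimes> hybrid"
    and \<epsilon> :: "hybrid \<Rightarrow> complex"
    and S :: "hybrid \<Rightarrow> hybrid"
  assumes b: "b \<noteq> 0"
    and linear_\<Delta>: "clinear \<Delta>"
    and \<Delta>_1: "\<Delta> 1 = (1/2) *\<^sub>C 1 \<otimes> 1 - (1/2) *\<^sub>C hyb_\<mu> \<otimes> hyb_\<mu>
          - (\<i>/2) *\<^sub>C hyb_\<nu> \<otimes> hyb_\<mu> - (\<i>/2) *\<^sub>C hyb_\<mu> \<otimes> hyb_\<nu>
          + (1/2) *\<^sub>C hyb_\<nu> \<otimes> hyb_\<nu>"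
    and \<Delta>_g: "\<Delta> hyb_g = - ((1/2) *\<^sub>C hyb_\<mu> \<otimes> 1) - (\<i>/2) *\<^sub>C hyb_\<nu> \<otimes> 1
          + b *\<^sub>C hyb_g \<otimes> hyb_g + b *\<^sub>C hyb_\<mu> \<otimes> hyb_g + (\<i> * b) *\<^sub>C hyb_\<nu> \<otimes> hyb_g
          - (1/2) *\<^sub>C 1 \<otimes> hyb_\<mu> + b *\<^sub>C hyb_g \<otimes> hyb_\<mu> + b *\<^sub>C hyb_\<mu> \<otimes> hyb_\<mu>
          + (\<i> * b) *\<^sub>C hyb_\<nu> \<otimes> hyb_\<mu> - (\<i>/2) *\<^sub>C 1 \<otimes> hyb_\<nu> + (\<i> * b) *\<^sub>C hyb_g \<otimes> hyb_\<nu>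
          + (\<i> * b) *\<^sub>C hyb_\<mu> \<otimes> hyb_\<nu> - b *\<^sub>C hyb_\<nu> \<otimes> hyb_\<nu>"
    and \<Delta>_\<mu>: "\<Delta> hyb_\<mu> = (1 / (2 * b)) *\<^sub>C hyb_\<mu> \<otimes> hyb_\<mu>"
    and \<Delta>_\<nu>: "\<Delta> hyb_\<nu> = - ((\<i>/2) *\<^sub>C hyb_\<mu> \<otimes> 1) + (1/2) *\<^sub>C hyb_\<nu> \<otimes> 1
          - (\<i>/2) *\<^sub>C 1 \<otimes> hyb_\<mu> + (\<i> / (2 * b)) *\<^sub>C hyb_\<mu> \<otimes> hyb_\<mu> + (1/2) *\<^sub>C 1 \<otimes> hyb_\<nu>"
    and linear_\<epsilon>: "clinear \<epsilon>"
    and \<epsilon>_values: "\<epsilon> 1 = 2" "\<epsilon> hyb_g = 1 / b" "\<epsilon> hyb_\<mu> = 2 * b" "\<epsilon> hyb_\<nu> = 2 * \<i> * b"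
    and linear_S: "clinear S"
    and S_1: "S 1 = 1"
    and S_g: "S hyb_g = (- 1 + 1 / (2 * b^2)) *\<^sub>C hyb_\<mu> - \<i> *\<^sub>C hyb_\<nu>"
    and S_\<mu>: "S hyb_\<mu> = (2 * b^2) *\<^sub>C hyb_g + (2 * b^2) *\<^sub>C hyb_\<mu> + (2 * \<i> * b^2) *\<^sub>C hyb_\<nu>"
    and S_\<nu>: "S hyb_\<nu> = (2 * \<i> * b^2) *\<^sub>C hyb_g - (\<i> - 2 * \<i> * b^2) *\<^sub>C hyb_\<mu>
          + (1 - 2 * b^2) *\<^sub>C hyb_\<nu>"
  shows "weak_hopf_algebra \<Delta> \<epsilon> S"
proof -
  note lin_simps = clinear_add clinear_diff clinear_scale
  \<comment> \<open>These rules expand both sides of an identity in the tensor square into the same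
    combination of tensors of basis elements.\<close>
  note vec_simps = tensor_prod_simps clinear_diff[OF clinear_tensor_prod_left]
    clinear_diff[OF clinear_tensor_prod_right] scaleC_add_right scaleC_scaleC
    complex_vector.scale_right_diff_distrib
  interpret matrix_unit_coalgebra "hyb_unit b" \<Delta> \<epsilon> S
  proof
    show "\<Delta> (hyb_unit b i j) = hyb_unit b i j \<otimes> hyb_unit b i j" for i j
      using b by (cases i; cases j)
        (simp_all add: hyb_unit_def lin_simps[OF linear_\<Delta>] \<Delta>_1 \<Delta>_g \<Delta>_\<mu> \<Delta>_\<nu> vec_simps mult_ac)
    show "\<epsilon> (hyb_unit b i j) = 1" for i j
      using b by (cases i; cases j)
        (simp_all add: hyb_unit_def lin_simps[OF linear_\<epsilon>] \<epsilon>_values field_simps)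
    show "S (hyb_unit b i j) = hyb_unit b j i" for i j
      using b
      \<comment> \<open>The values of \<open>S\<close> are stated for the named basis elements, so
        they are substituted before those names are unfolded into coordinates.\<close>
      by (cases i; cases j; simp add: hyb_unit_def lin_simps[OF linear_S] S_1 S_g S_\<mu> S_\<nu>)
        (simp_all add: hyb_g_def hyb_\<mu>_def hyb_\<nu>_def hybrid_defs power2_eq_square field_simps)
  qed (simp_all add: b hyb_unit_mult hyb_unit_span hyb_unit_one lin_simps[OF linear_\<Delta>]
      lin_simps[OF linear_\<epsilon>] lin_simps[OF linear_S])
  show ?thesis
    by (fact weak_hopf_algebra_axioms)
qed

end
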